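(* Let $q=p^k$ for some prime $p\ne 3$ and some integer $k>0$. Let $Q,R,S$ be integers each of the form $p^i$ for some integer $i\ge 0$ (the exponents may differ). Let $r>0$ be an integer with $r\equiv Q+R+S\pmod{q+1}$. Let $f(X):=X^rB(X^{q-1})$, where one of the following holds: (1) $B(X):=X^{Q+R}-X^{Q+S}-X^{R+S}+X^S-1$ and $(Q,R,S)\equiv\pm(1,1,1)\pmod 3$; (2) $B(X):=X^{Q+R}-X^{Q+S}-X^{R+S}-X^S-1$ and $(Q,R,S)\equiv\pm(1,1,1)\pmod 3$; (3) $B(X):=X^{R+S}-X^{Q+R}-X^{Q+S}+X^Q-1$ and $(Q,R,S)\equiv\pm(1,-1,1)\pmod 3$; (4) $B(X):=X^{R+S}-X^{Q+R}-X^{Q+S}-X^Q-1$ and $(Q,R,S)\equiv\pm(1,-1,1)\pmod 3$; (5) $B(X):=X^{Q+R+S}-X^Q-X^R-X^S+1$ and $(Q,R,S)\equiv\pm(1,1,-1)\pmod 3$; (6) $B(X):=X^{Q+R+S}-X^Q-X^R-X^S-1$ and $(Q,R,S)\equiv\pm(1,1,-1)\pmod 3$. Then $f(X)$ permutes $\mathbb{F}_{q^2}$ if and only if $q\equiv 1\pmod 3$ and $\gcd(r,q-1)=1$ and $\gcd(Q+R-S,q+1)=1$.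
   Context: A polynomial $f(X)\in\mathbb{F}_{q^2}[X]$ permutes $\mathbb{F}_{q^2}$ if the map $\alpha\mapsto f(\alpha)$ is a bijection of $\mathbb{F}_{q^2}$. For integers $\epsilon_1,\epsilon_2,\epsilon_3$, the notation $(Q,R,S)\equiv\pm(\epsilon_1,\epsilon_2,\epsilon_3)\pmod 3$ means that there is a single sign $s\in\{1,-1\}$ with $Q\equiv s\epsilon_1$, $R\equiv s\epsilon_2$, $S\equiv s\epsilon_3\pmod 3$. *)

theory Defs
  imports "HOL-Computational_Algebra.Polynomial" "HOL-Number_Theory.Cong" "HOL-Library.Cardinality"
begin

abbreviation X :: "'a::comm_semiring_1 poly" where
  "X \<equiv> [:0, 1:]"

definition permutation_poly :: "'a::comm_semiring_0 poly \<Rightarrow> bool" where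
  "permutation_poly f \<longleftrightarrow> bij (poly f)"

text \<open>The sign is common to all three components.\<close>

definition cong_pm_3 :: "nat \<times> nat \<times> nat \<Rightarrow> int \<times> int \<times> int \<Rightarrow> bool" where
  "cong_pm_3 = (\<lambda>(Q, R, S) (e1, e2, e3).
     \<exists>s\<in>{1, -1}. [int Q = s * e1] (mod 3) \<and> [int R = s * e2] (mod 3) \<and> [int S = s * e3] (mod 3))"

end

theory Submission
  imports Defs
begin

text \<open>
  Write \<open>\<mu>\<close> for the group of \<open>(q + 1)\<close>-th roots of unity in the field with \<open>q\<^sup>2\<close> elements and \<open>w\<close> for
  a primitive cube root of unity there; \<open>w\<close> exists because 3 divides \<open>q\<^sup>2 - 1\<close>. By the usual
  reduction, \<open>bij_power_mult_iff\<close>, \<open>f\<close> is a permutation iff \<open>gcd r (q - 1) = 1\<close> and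
  \<open>g x = x\<^sup>r B(x)\<^sup>q\<^sup>-\<^sup>1\<close> permutes \<open>\<mu>\<close>, so everything rests on understanding \<open>g\<close>.

  The key is the fractional linear map \<open>\<sigma> x = (w\<^sup>2 x - 1) / (x - w\<^sup>2)\<close>, called \<open>twist w\<close> below. It is
  an involution that commutes with inversion, and for a power \<open>Q\<close> of the characteristic it satisfies
  \<open>\<sigma> (u\<^sup>Q) = (\<sigma> u)\<^sup>Q\<close> or \<open>\<sigma> (u\<^sup>Q) = (\<sigma> u)\<^sup>-\<^sup>Q\<close> according as \<open>Q\<close> is 1 or -1 modulo 3, since the
  Frobenius map fixes \<open>w\<close> or swaps it with \<open>w\<^sup>2\<close> (\<open>twist_powi\<close>). If \<open>q\<close> is 1 modulo 3, taking
  \<open>q\<close>-th powers fixes \<open>w\<close> and inverts \<open>\<mu>\<close>, and hence \<open>\<sigma>\<close> permutes \<open>\<mu>\<close> (\<open>twist_unity_roots\<close>).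
  Conjugating multiplication by \<open>\<sigma>\<close> gives a ternary operation with a short formula
  (\<open>twist_triple_product\<close>):
  \<open>\<sigma> (\<sigma> a \<cdot> \<sigma> b \<cdot> \<sigma> c) = (1 - ab - ac - bc - abc) / (abc - a - b - c - 1)\<close>.

  All six polynomials \<open>B\<close> have one shape. After replacing \<open>x\<close> by \<open>u = \<plusminus>x\<close>, each is, up to sign and a
  power of \<open>u\<close>, the denominator \<open>abc - a - b - c - 1\<close> at \<open>a = u\<^sup>\<plusminus>\<^sup>Q\<close>, \<open>b = u\<^sup>\<plusminus>\<^sup>R\<close>, \<open>c = u\<^sup>\<plusminus>\<^sup>S\<close>, with the signs
  matched to the residues of \<open>Q\<close>, \<open>R\<close>, \<open>S\<close> modulo 3. On \<open>\<mu>\<close> raising to the power \<open>q\<close> is inversion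
  in each of \<open>a\<close>, \<open>b\<close>, \<open>c\<close>, so \<open>B(x)\<^sup>q / B(x)\<close> is, up to a monomial that the congruence on \<open>r\<close>
  cancels, the right-hand side of the formula. Consequently \<open>g\<close> is, up to sign changes, \<open>\<sigma>\<close> followed
  by the power map with exponent \<open>\<plusminus>(Q + R - S)\<close> followed by \<open>\<sigma>\<close>, and it permutes \<open>\<mu>\<close> iff
  \<open>Q + R - S\<close> is coprime to \<open>q + 1\<close>. If instead \<open>q\<close> is 2 modulo 3, then \<open>w\<close> lies in \<open>\<mu>\<close> and \<open>B\<close>
  vanishes at \<open>\<plusminus>w\<close>, so \<open>g\<close> does not even map \<open>\<mu>\<close> to itself. The common
  statement for the six shapes is \<open>twisted_product_permutes_iff\<close>.
\<close>

section \<open>Roots of unity in a finite field\<close>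

definition unity_roots :: "nat \<Rightarrow> 'a::field set" where
  "unity_roots n = {x. x ^ n = 1}"

lemma unity_roots_nonzero: "x \<in> unity_roots n \<Longrightarrow> n > 0 \<Longrightarrow> x \<noteq> 0"
  by (auto simp: unity_roots_def power_0_left)

lemma powi_in_unity_roots: "x \<in> unity_roots n \<Longrightarrow> x powi m \<in> unity_roots n"
  by (simp add: unity_roots_def power_int_power' mult.commute[of m] power_int_mult)

lemma mult_in_unity_roots: "x \<in> unity_roots n \<Longrightarrow> y \<in> unity_roots n \<Longrightarrow> x * y \<in> unity_roots n"
  by (simp add: unity_roots_def power_mult_distrib)

lemma card_power_fibre_le:
  fixes a :: "'a::field"
  assumes "n > 0"
  shows "card {x. x ^ n = a} \<le> n"
proof -
  let ?P = "monom 1 n - [:a:]"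
  have "degree ?P = n"
    unfolding diff_conv_add_uminus
    using assms by (subst degree_add_eq_left) (simp_all add: degree_monom_eq)
  moreover from this have "?P \<noteq> 0"
    using assms by auto
  moreover have "{x. x ^ n = a} = {x. poly ?P x = 0}"
    by (simp add: poly_monom)
  ultimately show ?thesis
    using card_poly_roots_bound[of ?P] by simp
qed

lemma power_card_units_eq_1:
  fixes x :: "'a::{field,finite}"
  assumes "x \<noteq> 0"
  shows "x ^ (CARD('a) - 1) = 1"
proof -
  have "(\<Prod>y\<in>UNIV-{0}. x * y) = (\<Prod>y\<in>UNIV-{0}. y)"
    by (rule prod.reindex_bij_witness[of _ "\<lambda>y. y / x" "\<lambda>y. x * y"]) (use assms in auto)
  moreover have "(\<Prod>y\<in>UNIV-{0}. x * y) = x ^ (CARD('a) - 1) * \<Prod>(UNIV-{0})"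
    by (simp add: prod.distrib)
  moreover have "\<Prod>(UNIV-{0::'a}) \<noteq> 0"
    by simp
  ultimately show ?thesis
    by (metis mult_cancel_right1)
qed

text \<open>
  Counting replaces cyclicity of the multiplicative group: the \<open>s\<close>-th power map sends the \<open>s * d\<close>
  nonzero elements into \<open>unity_roots d\<close> with fibres of size at most \<open>s\<close>, so its image has at least
  \<open>d\<close> elements, whereas \<open>unity_roots d\<close> has at most \<open>d\<close>.
\<close>

lemma power_image_nonzero_eq_unity_roots:
  fixes s d :: nat
  assumes "CARD('a::{field,finite}) - 1 = s * d" and "s > 0" and "d > 0"
  shows "(\<lambda>x::'a. x ^ s) ` (UNIV - {0}) = unity_roots d" and "card (unity_roots d :: 'a set) = d"
proof -
  let ?U = "UNIV - {0::'a}" and ?I = "(\<lambda>x::'a. x ^ s) ` (UNIV - {0})"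
  have sub: "?I \<subseteq> unity_roots d"
    using power_card_units_eq_1[where ?'a = 'a] unfolding assms(1)
    by (auto simp: unity_roots_def simp flip: power_mult)
  have le: "card (unity_roots d :: 'a set) \<le> d"
    unfolding unity_roots_def using assms(3) by (rule card_power_fibre_le)
  have "s * d = card ?U"
    using assms(1) by simp
  also have "\<dots> = card (\<Union>y\<in>?I. {x\<in>?U. x ^ s = y})"
    by (rule arg_cong[of _ _ card]) auto
  also have "\<dots> \<le> (\<Sum>y\<in>?I. card {x\<in>?U. x ^ s = y})"
    by (rule card_UN_le) simp
  also have "\<dots> \<le> (\<Sum>y\<in>?I. s)"
    by (intro sum_mono order_trans[OF card_mono card_power_fibre_le[OF assms(2)]]) auto
  finally have "d \<le> card ?I"
    using assms(2) by (simp add: mult.commute)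
  with le have "card (unity_roots d :: 'a set) \<le> card ?I"
    by simp
  then show "?I = unity_roots d"
    using sub by (intro card_seteq) auto
  with le \<open>d \<le> card ?I\<close> show "card (unity_roots d :: 'a set) = d"
    by simp
qed

lemma obtain_unity_root:
  assumes "g dvd CARD('a::{field,finite}) - 1" and "g > 1"
  obtains z :: "'a::{field,finite}" where "z ^ g = 1" and "z \<noteq> 1"
proof -
  have "CARD('a) - 1 \<noteq> 0"
    using card_mono[of "UNIV :: 'a set" "{0, 1}"] by simp
  moreover obtain s where s: "CARD('a) - 1 = s * g"
    using assms(1) by (metis dvdE mult.commute)
  ultimately have "card (unity_roots g :: 'a set) = g"
    using assms(2) by (intro power_image_nonzero_eq_unity_roots(2)[OF s]) (auto intro: gr0I)
  then have "\<not> unity_roots g \<subseteq> {1 :: 'a}"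
    using assms(2) card_mono[of "{1::'a}" "unity_roots g"] by auto
  then show ?thesis
    using that by (auto simp: unity_roots_def)
qed

lemma powi_eq_1_of_coprime:
  fixes x :: "'a::field"
  assumes "x \<noteq> 0" and "x powi m = 1" and "x powi n = 1" and "coprime m n"
  shows "x = 1"
proof -
  obtain u v where "u * m + v * n = 1"
    using assms(4) bezout_int[of m n] by auto
  then have "x = x powi (m * u + n * v)"
    by (simp add: mult.commute)
  also have "\<dots> = 1"
    using assms(1-3) by (simp add: power_int_add power_int_mult)
  finally show ?thesis .
qed

text \<open>
  A common divisor \<open>g > 1\<close> of \<open>m\<close> and \<open>n\<close> yields a nontrivial \<open>g\<close>-th root of unity in the kernel
  of the power map; coprimality makes the kernel trivial by Bezout.
\<close>

lemma bij_betw_powi_unity_roots_iff: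
  assumes "CARD('a::{field,finite}) - 1 = s * n" and "n > 0"
  shows "bij_betw (\<lambda>y::'a. y powi m) (unity_roots n) (unity_roots n) \<longleftrightarrow> coprime m (int n)"
proof
  assume bij: "bij_betw (\<lambda>y::'a. y powi m) (unity_roots n) (unity_roots n)"
  show "coprime m (int n)"
  proof (rule ccontr)
    assume "\<not> coprime m (int n)"
    define g where "g = nat (gcd m (int n))"
    have g: "int g = gcd m (int n)"
      by (simp add: g_def)
    have "gcd m (int n) \<noteq> 1" "gcd m (int n) > 0"
      using \<open>\<not> coprime m (int n)\<close> assms(2) by (auto simp: coprime_iff_gcd_eq_1)
    then have "g > 1"
      using g by linarith
    have "g dvd n"
      using g by (metis gcd_dvd2 int_dvd_int_iff)
    then have "g dvd CARD('a) - 1"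
      unfolding assms(1) by (rule dvd_mult)
    with \<open>g > 1\<close> obtain z :: 'a where z: "z ^ g = 1" "z \<noteq> 1"
      using obtain_unity_root by blast
    obtain i where "n = g * i"
      using \<open>g dvd n\<close> by auto
    then have "z \<in> unity_roots n"
      using z by (simp add: unity_roots_def power_mult)
    moreover have "1 \<in> unity_roots n"
      by (simp add: unity_roots_def)
    moreover have "z powi m = 1 powi m"
    proof -
      obtain j where "m = int g * j"
        using g by (metis dvdE gcd_dvd1)
      then show ?thesis
        using z by (simp add: power_int_mult)
    qed
    ultimately show False
      using bij z(2) unfolding bij_betw_def inj_on_def by blast
  qed
next
  assume cop: "coprime m (int n)"
  have "inj_on (\<lambda>y::'a. y powi m) (unity_roots n)"
  proof (rule inj_onI)
    fix x y :: 'a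
    assume x: "x \<in> unity_roots n" and y: "y \<in> unity_roots n" and eq: "x powi m = y powi m"
    have nz: "x \<noteq> 0" "y \<noteq> 0"
      using x y assms(2) unity_roots_nonzero by auto
    have "x / y = 1"
    proof (rule powi_eq_1_of_coprime[OF _ _ _ cop])
      show "(x / y) powi m = 1"
        using eq nz by (simp add: power_int_divide_distrib)
      show "(x / y) powi int n = 1"
        using x y by (simp add: unity_roots_def power_divide)
    qed (use nz in simp)
    then show "x = y"
      using nz by simp
  qed
  moreover have "(\<lambda>y::'a. y powi m) ` unity_roots n \<subseteq> unity_roots n"
    using powi_in_unity_roots by auto
  ultimately show "bij_betw (\<lambda>y::'a. y powi m) (unity_roots n) (unity_roots n)"
    by (simp add: bij_betw_def endo_inj_surj)
qed

section \<open>Permutations of the form \<open>x\<^sup>r h(x\<^sup>s)\<close>\<close>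

text \<open>
  The map \<open>f x = x\<^sup>r h(x\<^sup>s)\<close> lies over \<open>g x = x\<^sup>r h(x)\<^sup>s\<close> via the \<open>s\<close>-th power map, whose image
  on nonzero elements is \<open>unity_roots d\<close>; on a fibre, \<open>f\<close> is a constant multiple of \<open>x\<^sup>r\<close>, which is
  injective there iff \<open>gcd r s = 1\<close>. The condition that \<open>g\<close> maps \<open>unity_roots d\<close> to itself
  also encodes that \<open>h\<close> has no zero on that set.
\<close>

theorem bij_power_mult_iff:
  fixes h :: "'a::{field,finite} \<Rightarrow> 'a"
  assumes card: "CARD('a) - 1 = s * d" and "s > 0" and "d > 0" and "r > 0"
  shows "bij (\<lambda>x. x ^ r * h (x ^ s)) \<longleftrightarrow>
    gcd r s = 1 \<and> bij_betw (\<lambda>x. x ^ r * h x ^ s) (unity_roots d) (unity_roots d)"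
proof -
  define f g where "f = (\<lambda>x. x ^ r * h (x ^ s))" and "g = (\<lambda>x. x ^ r * h x ^ s)"
  let ?M = "unity_roots d :: 'a set"
  note img = power_image_nonzero_eq_unity_roots(1)[OF card assms(2,3), symmetric]
  have semiconj: "f x ^ s = g (x ^ s)" for x
    by (simp add: f_def g_def power_mult_distrib mult.commute flip: power_mult)
  have f0: "f 0 = 0"
    using assms by (simp add: f_def)
  have "gcd r s = 1 \<and> bij_betw g ?M ?M" if bij: "bij f"
  proof
    have f_nz: "f w \<noteq> 0" if "w \<noteq> 0" for w
      using that f0 bij by (metis bij_pointE)
    show "gcd r s = 1"
    proof (rule ccontr)
      assume "gcd r s \<noteq> 1"
      then have "gcd r s > 1"
        using assms(2) gcd_pos_nat[of r s] by linarith
      moreover have "gcd r s dvd CARD('a) - 1"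
        using card by simp
      ultimately obtain z :: 'a where z: "z ^ gcd r s = 1" "z \<noteq> 1"
        using obtain_unity_root by blast
      have pow1: "z ^ e = 1" if "gcd r s dvd e" for e
        using that z by (auto simp: power_mult)
      have "f z = f 1"
        using pow1[of r] pow1[of s] by (simp add: f_def)
      then show False
        using bij z(2) by (meson bij_def injD)
    qed
    have "g ` ?M \<subseteq> ?M"
    proof
      fix y assume "y \<in> g ` ?M"
      then obtain w where w: "w \<noteq> 0" "y = g (w ^ s)"
        unfolding img by blast
      then have "y = f w ^ s"
        by (simp add: semiconj)
      then show "y \<in> ?M"
        using f_nz[OF w(1)] unfolding img by blast
    qed
    moreover have "?M \<subseteq> g ` ?M"
    proof
      fix y assume "y \<in> ?M"
      then obtain v where v: "v \<noteq> 0" "y = v ^ s"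
        unfolding img by blast
      obtain w where w: "v = f w"
        using bij by (metis bij_pointE)
      then have "w \<noteq> 0"
        using v(1) f0 by auto
      moreover have "y = g (w ^ s)"
        using v(2) w semiconj[of w] by simp
      ultimately show "y \<in> g ` ?M"
        unfolding img by blast
    qed
    ultimately have "g ` ?M = ?M"
      by (rule subset_antisym)
    then show "bij_betw g ?M ?M"
      by (simp add: bij_betw_def eq_card_imp_inj_on)
  qed
  moreover have "bij f" if gcd: "gcd r s = 1" and bij: "bij_betw g ?M ?M"
  proof -
    have f_nz: "f x \<noteq> 0" if "x \<noteq> 0" for x
    proof
      assume "f x = 0"
      then have "g (x ^ s) = 0"
        using assms(2) semiconj[of x] by (simp add: power_0_left)
      moreover have "x ^ s \<in> ?M"
        using that unfolding img by blast
      ultimately have "0 \<in> ?M"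
        using bij bij_betw_apply by fastforce
      then show False
        using assms(3) unity_roots_nonzero by blast
    qed
    have "inj f"
    proof (rule injI)
      fix x y assume eq: "f x = f y"
      show "x = y"
      proof (cases "x = 0 \<or> y = 0")
        case True
        then have "f x = 0" "f y = 0"
          using eq f0 by auto
        then show ?thesis
          using f_nz[of x] f_nz[of y] by blast
      next
        case False
        then have "x ^ s \<in> ?M" "y ^ s \<in> ?M"
          unfolding img by blast+
        moreover have "g (x ^ s) = g (y ^ s)"
          using eq semiconj[of x] semiconj[of y] by simp
        ultimately have xys: "x ^ s = y ^ s"
          using bij unfolding bij_betw_def inj_on_def by blast
        then have xyr: "x ^ r = y ^ r"
          using eq f_nz[of x] False by (simp add: f_def)
        have "coprime (int r) (int s)"
          using gcd by (simp add: coprime_iff_gcd_eq_1)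
        then have "x / y = 1"
          using powi_eq_1_of_coprime[of "x / y" "int r" "int s"] False xys xyr
          by (simp add: power_divide)
        then show ?thesis
          using False by simp
      qed
    qed
    then show "bij f"
      by (simp add: bij_def finite_UNIV_inj_surj)
  qed
  ultimately show ?thesis
    unfolding f_def g_def by argo
qed

section \<open>Finite fields of given characteristic\<close>

lemma CHAR_eq_of_CARD_prime_power:
  assumes "CARD('a::{field,finite}) = p ^ n" and "prime p"
  shows "CHAR('a) = p"
proof -
  have "(\<Sum>x\<in>(UNIV::'a set). x + 1) = (\<Sum>x\<in>(UNIV::'a set). x)"
    by (rule sum.reindex_bij_witness[of _ "\<lambda>x. x - 1" "\<lambda>x. x + 1"]) auto
  then have "of_nat CARD('a) = (0::'a)"
    by (simp add: sum.distrib)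
  then have "CHAR('a) dvd p ^ n"
    unfolding assms(1) of_nat_eq_0_iff_char_dvd .
  moreover have "prime CHAR('a)"
    using finite_imp_CHAR_pos[where ?'a = 'a] by (simp add: prime_CHAR_semidom)
  ultimately show ?thesis
    using assms(2) by (metis prime_dvd_power primes_dvd_imp_eq)
qed

lemma frobenius_minus:
  fixes x y :: "'a::comm_ring_1"
  assumes "prime CHAR('a)" and "Q = CHAR('a) ^ i"
  shows "(x - y) ^ Q = x ^ Q - y ^ Q"
  using freshmans_dream'[OF assms, of "x - y" y] by simp

lemma sign_power_char:
  fixes e :: "'a::comm_ring_1"
  assumes "prime CHAR('a)" and "Q = CHAR('a) ^ i" and "e \<in> {1, -1}"
  shows "e ^ Q = e"
proof -
  have "Q > 0"
    using assms(1,2) prime_gt_0_nat by simp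
  then show ?thesis
    using assms(3) frobenius_minus[OF assms(1,2), of 0 1] by (auto simp: power_0_left)
qed

section \<open>A fractional linear involution attached to a cube root of unity\<close>

text \<open>
  For a primitive cube root of unity \<open>w\<close> this is \<open>w\<^sup>2 (x - w) / (x - w\<^sup>2)\<close>. The factor \<open>w\<^sup>2\<close> makes the
  matrix traceless, so that the map is an involution, and lets it preserve the
  \<open>(q + 1)\<close>-th roots of unity when \<open>q\<close> is 1 modulo 3.
\<close>

definition twist :: "'a::field \<Rightarrow> 'a \<Rightarrow> 'a" where
  "twist w x = (w\<^sup>2 * x - 1) / (x - w\<^sup>2)"

lemma cube_root_eqs:
  fixes w :: "'a::field"
  assumes "w\<^sup>2 + w + 1 = 0"
  shows "w ^ 3 = 1" and "w \<noteq> 0" and "inverse w = w\<^sup>2"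
proof -
  show w3: "w ^ 3 = 1"
    using assms by algebra
  then show "w \<noteq> 0"
    by (auto simp: power_0_left)
  then show "inverse w = w\<^sup>2"
    using w3 by (simp add: field_simps power2_eq_square power3_eq_cube)
qed

lemma power_mod_order:
  fixes x :: "'a::field"
  assumes "x ^ n = 1" and "[i = j] (mod n)"
  shows "x ^ i = x ^ j"
proof -
  have "x ^ i = x ^ (i mod n)" for i
  proof -
    have "x ^ i = x ^ (n * (i div n) + i mod n)"
      by simp
    also have "\<dots> = x ^ (i mod n)"
      unfolding power_add power_mult assms(1) by simp
    finally show ?thesis .
  qed
  from this[of i] this[of j] show ?thesis
    using assms(2) by (simp add: cong_def)
qed

lemma powi_mod_order:
  fixes x :: "'a::field"
  assumes "x \<noteq> 0" and "x ^ n = 1" and "[i = j] (mod int n)"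
  shows "x powi i = x powi j"
proof -
  obtain l where "i = j + int n * l"
    using assms(3) by (metis cong_iff_lin cong_sym)
  then show ?thesis
    using assms(1,2) by (simp add: power_int_add power_int_mult)
qed

lemma twist_inverse:
  fixes w :: "'a::field"
  assumes w: "w\<^sup>2 + w + 1 = 0" and "a \<noteq> 0"
  shows "twist w (inverse a) = inverse (twist w a)"
proof -
  have "twist w (inverse a) = (w\<^sup>2 - a) / (1 - w\<^sup>2 * a)"
    using assms(2) unfolding twist_def
    by (subst mult_divide_mult_cancel_left[of a, symmetric]) (simp_all add: algebra_simps)
  also have "\<dots> = (a - w\<^sup>2) / (w\<^sup>2 * a - 1)"
    by (metis minus_diff_eq minus_divide_divide)
  finally show ?thesis
    by (simp add: twist_def)
qed

text \<open>
  Raising to the power \<open>Q\<close> is a field endomorphism sending \<open>w\<close> to \<open>w\<close> or to its inverse according to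
  \<open>Q\<close> modulo 3, and exchanging \<open>w\<close> with its inverse turns \<open>twist w\<close> into its reciprocal. A sign \<open>d\<close>
  in the exponent contributes another inversion by \<open>twist_inverse\<close>.
\<close>

lemma twist_powi:
  fixes w u :: "'a::field"
  assumes char: "prime CHAR('a)" "Q = CHAR('a) ^ i" and w: "w\<^sup>2 + w + 1 = 0"
    and "u \<noteq> 0" and "d \<in> {1, -1}" and "s \<in> {1, -1}" and "[int Q = s * d] (mod 3)"
  shows "twist w (u powi (d * int Q)) = twist w u powi (s * int Q)"
proof -
  note w' = cube_root_eqs[OF w]
  have *: "twist w (u ^ Q) = twist w u powi (e * int Q)"
    if e: "e \<in> {1, -1}" "[int Q = e] (mod 3)" for e
  proof -
    have frob: "twist w u ^ Q = ((w ^ Q)\<^sup>2 * u ^ Q - 1) / (u ^ Q - (w ^ Q)\<^sup>2)"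
      by (simp add: twist_def power_divide frobenius_minus[OF char] power_mult_distrib
          power_mult[symmetric] mult.commute)
    have wQ: "w ^ Q = w powi e"
      using powi_mod_order[of w 3 "int Q" e] w' e by simp
    show ?thesis
    proof (cases "e = 1")
      case True
      then show ?thesis
        using frob wQ by (simp add: twist_def)
    next
      case False
      then have [simp]: "e = -1"
        using e by simp
      have w4: "(w\<^sup>2)\<^sup>2 = w"
        using w by algebra
      have "inverse (twist w u ^ Q) = (u ^ Q - w) / (w * u ^ Q - 1)"
        using frob wQ w' w4 by (simp add: power_int_minus)
      also have "\<dots> = (w\<^sup>2 * (u ^ Q - w)) / (w\<^sup>2 * (w * u ^ Q - 1))"
        using w' by simp
      also have "\<dots> = (w\<^sup>2 * u ^ Q - 1) / (u ^ Q - w\<^sup>2)"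
      proof -
        have "w\<^sup>2 * (u ^ Q - w) = w\<^sup>2 * u ^ Q - 1"
          using w by algebra
        moreover have "w\<^sup>2 * (w * u ^ Q - 1) = w ^ 3 * u ^ Q - w\<^sup>2"
          by (simp add: algebra_simps power2_eq_square power3_eq_cube)
        ultimately show ?thesis
          using w'(1) by simp
      qed
      finally show ?thesis
        by (simp add: twist_def power_int_minus)
    qed
  qed
  show ?thesis
  proof (cases "d = 1")
    case True
    then show ?thesis
      using *[of s] assms(6,7) by simp
  next
    case False
    then have [simp]: "d = -1"
      using assms(5) by simp
    have "twist w (u powi (d * int Q)) = inverse (twist w (u ^ Q))"
      using twist_inverse[OF w, of "u ^ Q"] assms(4) by (simp add: power_int_minus)
    also have "\<dots> = inverse (twist w u powi (- s * int Q))"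
      using *[of "-s"] assms(6,7) by auto
    finally show ?thesis
      by (simp add: power_int_minus)
  qed
qed

lemma twist_twist:
  fixes w :: "'a::field"
  assumes w: "w\<^sup>2 + w + 1 = 0" and "w \<noteq> 1" and "u \<noteq> w\<^sup>2"
  shows "twist w (twist w u) = u"
proof -
  have nz: "u - w\<^sup>2 \<noteq> 0" "w - 1 \<noteq> 0"
    using assms by auto
  have num: "w\<^sup>2 * twist w u - 1 = (w - 1) * u / (u - w\<^sup>2)"
  proof -
    have "w\<^sup>2 * (w\<^sup>2 * u - 1) - (u - w\<^sup>2) = (w - 1) * u"
      using w by algebra
    then show ?thesis
      using nz by (simp add: twist_def divide_simps)
  qed
  have den: "twist w u - w\<^sup>2 = (w - 1) / (u - w\<^sup>2)"
  proof -
    have "(w\<^sup>2 * u - 1) - w\<^sup>2 * (u - w\<^sup>2) = w - 1"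
      using w by algebra
    then show ?thesis
      using nz by (simp add: twist_def divide_simps)
  qed
  show ?thesis
    using nz by (simp add: twist_def[of w "twist w u"] num den)
qed

text \<open>
  With \<open>N / D\<close> the product of the three values, both \<open>N\<close> and \<open>D\<close> are combinations of the elementary
  symmetric functions of \<open>a\<close>, \<open>b\<close>, \<open>c\<close> with coefficients powers of \<open>w\<close>. In the
  denominator \<open>N - w\<^sup>2 D\<close> the terms in \<open>ab + ac + bc\<close> cancel, and in the numerator \<open>w\<^sup>2 N - D\<close> those in
  \<open>a + b + c\<close>; a common factor \<open>1 - w\<^sup>2\<close> remains.
\<close>

lemma twist_triple_product:
  fixes w a b c :: "'a::field"
  assumes w: "w\<^sup>2 + w + 1 = 0" and "w\<^sup>2 \<noteq> 1"
    and "a \<noteq> w\<^sup>2" and "b \<noteq> w\<^sup>2" and "c \<noteq> w\<^sup>2"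
    and T: "twist w a * twist w b * twist w c \<noteq> w\<^sup>2"
  shows "a * b * c - a - b - c - 1 \<noteq> 0" (is "?H \<noteq> 0")
    and "twist w (twist w a * twist w b * twist w c)
      = (1 - a * b - a * c - b * c - a * b * c) / (a * b * c - a - b - c - 1)" (is "_ = ?K / _")
proof -
  define N D where "N = (w\<^sup>2 * a - 1) * (w\<^sup>2 * b - 1) * (w\<^sup>2 * c - 1)"
    and "D = (a - w\<^sup>2) * (b - w\<^sup>2) * (c - w\<^sup>2)"
  have D: "D \<noteq> 0"
    using assms(3-5) by (simp add: D_def)
  have prod: "twist w a * twist w b * twist w c = N / D"
    by (simp add: twist_def N_def D_def)
  have den: "N - w\<^sup>2 * D = (1 - w\<^sup>2) * ?H"
    using w unfolding N_def D_def by algebra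
  have num: "w\<^sup>2 * N - D = (1 - w\<^sup>2) * ?K"
    using w unfolding N_def D_def by algebra
  have "N - w\<^sup>2 * D \<noteq> 0"
    using T D unfolding prod by (auto simp: field_simps)
  then show "?H \<noteq> 0"
    using den by auto
  have "twist w (N / D) = (w\<^sup>2 * N - D) / (N - w\<^sup>2 * D)"
    using D unfolding twist_def
    by (subst mult_divide_mult_cancel_left[of D, symmetric]) (simp_all add: algebra_simps)
  also have "\<dots> = ?K / ?H"
    unfolding num den using assms(2) by simp
  finally show "twist w (twist w a * twist w b * twist w c) = ?K / ?H"
    unfolding prod .
qed

text \<open>
  Since \<open>q + 1\<close> is 2 modulo 3, neither \<open>w\<close> nor \<open>w\<^sup>2\<close> is a \<open>(q + 1)\<close>-th root of unity, so \<open>twist w\<close> has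
  no pole or zero on these roots. They are the nonzero elements \<open>u\<close> with \<open>u ^ q = inverse u\<close>, and
  \<open>twist w\<close> commutes both with \<open>q\<close>-th powers and with inversion.
\<close>

lemma twist_unity_roots:
  fixes w :: "'a::field"
  assumes char: "prime CHAR('a)" "q = CHAR('a) ^ k" and w: "w\<^sup>2 + w + 1 = 0" "w \<noteq> 1"
    and q: "[q = 1] (mod 3)" and u: "u \<in> unity_roots (q + 1)"
  shows "w\<^sup>2 \<notin> unity_roots (q + 1)" and "u \<noteq> w\<^sup>2" and "twist w u \<in> unity_roots (q + 1)"
    and "twist w (twist w u) = u"
proof -
  note w' = cube_root_eqs[OF w(1)]
  have "w\<^sup>2 \<noteq> 1"
    using w' w(2) by (metis inverse_eq_1_iff)
  have "[q + 1 = 2] (mod 3)"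
    using q cong_add_rcancel_nat[of q 1 1] by (simp add: numeral_2_eq_2)
  then have wq: "w ^ (q + 1) = w\<^sup>2"
    using power_mod_order w'(1) by blast
  have w_notin: "w \<notin> unity_roots (q + 1)"
    using wq \<open>w\<^sup>2 \<noteq> 1\<close> by (simp add: unity_roots_def)
  show w2_notin: "w\<^sup>2 \<notin> unity_roots (q + 1)"
  proof
    assume "w\<^sup>2 \<in> unity_roots (q + 1)"
    then have "w\<^sup>2 powi (-1) \<in> unity_roots (q + 1)"
      by (rule powi_in_unity_roots)
    moreover have "w\<^sup>2 powi (-1) = w"
      by (simp flip: w'(3) add: power_int_minus)
    ultimately show False
      using w_notin by simp
  qed
  then show "u \<noteq> w\<^sup>2"
    using u by auto
  then show "twist w (twist w u) = u"
    by (rule twist_twist[OF w])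
  have "u \<noteq> 0"
    using unity_roots_nonzero[OF u] by simp
  have "u \<noteq> w"
    using u w_notin by auto
  moreover have "w\<^sup>2 * u - 1 = w\<^sup>2 * (u - w)"
    using w'(1) by (simp add: algebra_simps power2_eq_square power3_eq_cube)
  ultimately have nz: "twist w u \<noteq> 0"
    using \<open>u \<noteq> w\<^sup>2\<close> w' by (simp add: twist_def)
  have "u ^ q = inverse u"
    using u by (intro inverse_unique[symmetric]) (simp add: unity_roots_def)
  then have "inverse (twist w u) = twist w (u ^ q)"
    using twist_inverse[OF w(1) \<open>u \<noteq> 0\<close>] by simp
  also have "\<dots> = twist w u ^ q"
  proof -
    have "[int q = 1 * 1] (mod 3)"
      using q by (simp add: cong_int_iff[symmetric])
    then show ?thesis
      using twist_powi[OF char w(1) \<open>u \<noteq> 0\<close>, of 1 1] by simp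
  qed
  finally have "inverse (twist w u) = twist w u ^ q" .
  then show "twist w u \<in> unity_roots (q + 1)"
    using nz by (simp add: unity_roots_def flip: \<open>inverse (twist w u) = twist w u ^ q\<close>)
qed

section \<open>The permutation criterion\<close>

lemma obtain_cube_root:
  assumes "CARD('a) = q\<^sup>2" and "\<not> 3 dvd q"
  obtains w :: "'a::{field,finite}" where "w\<^sup>2 + w + 1 = 0" and "w \<noteq> 1"
proof -
  have "q mod 3 = 1 \<or> q mod 3 = 2"
    using assms(2) by (auto simp: dvd_eq_mod_eq_0)
  then have "q\<^sup>2 mod 3 = 1"
    by (auto simp: power_mod[of q 3 2, symmetric])
  then have "3 dvd CARD('a) - 1"
    unfolding assms(1) by presburger
  then obtain w :: 'a where w: "w ^ 3 = 1" "w \<noteq> 1"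
    using obtain_unity_root[of 3] by auto
  have "(w - 1) * (w\<^sup>2 + w + 1) = w ^ 3 - 1"
    by (simp add: algebra_simps power2_eq_square power3_eq_cube)
  then show ?thesis
    using that w by simp
qed

lemma power_minus_one_eq_quotient:
  fixes y :: "'a::field"
  assumes "y \<noteq> 0" and "q > 0"
  shows "y ^ (q - 1) = y ^ q / y"
  using assms power_diff[of y 1 q] by simp

text \<open>
  The parameters put all the shapes of \<open>B\<close> on one footing: \<open>\<eta>\<close> is the sign in \<open>u = \<eta> x\<close>, the
  \<open>d\<^sub>i\<close> are the signs in \<open>a = u\<^sup>\<plusminus>\<^sup>Q\<close>, \<open>b = u\<^sup>\<plusminus>\<^sup>R\<close>, \<open>c = u\<^sup>\<plusminus>\<^sup>S\<close>, and \<open>\<kappa> u\<^sup>e\<close> is the monomial that clears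
  the negative powers. The congruences modulo 3 say that \<open>twist w\<close> sends \<open>a\<close>, \<open>b\<close>, \<open>c\<close> to the powers of
  \<open>twist w u\<close> with exponents \<open>s * Q\<close>, \<open>s * R\<close>, \<open>- s * S\<close>; the equation for \<open>e\<close> says that
  \<open>x\<^sup>r\<close> exactly cancels the monomial left over in \<open>B(x)\<^sup>q\<^sup>-\<^sup>1\<close>.
\<close>

theorem twisted_product_permutes_iff:
  fixes B :: "'a::{field,finite} \<Rightarrow> 'a" and p k q Q R S r :: nat and e d\<^sub>1 d\<^sub>2 d\<^sub>3 s :: int
  assumes "prime p" and "p \<noteq> 3" and "k > 0" and q: "q = p ^ k" and card: "CARD('a) = q\<^sup>2"
    and Q: "Q = p ^ i" and R: "R = p ^ j" and S: "S = p ^ l"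
    and r_pos: "r > 0" and r: "[r = Q + R + S] (mod (q + 1))"
    and \<eta>: "\<eta> \<in> {1, -1}" and \<kappa>: "\<kappa> \<in> {1, -1}"
    and d: "d\<^sub>1 \<in> {1, -1}" "d\<^sub>2 \<in> {1, -1}" "d\<^sub>3 \<in> {1, -1}"
    and s: "s \<in> {1, -1}"
    and mod3: "[int Q = s * d\<^sub>1] (mod 3)" "[int R = s * d\<^sub>2] (mod 3)" "[int S = - s * d\<^sub>3] (mod 3)"
    and e: "2 * e + d\<^sub>1 * int Q + d\<^sub>2 * int R + d\<^sub>3 * int S = int (Q + R + S)"
    and B: "\<And>u. u \<noteq> 0 \<Longrightarrow> B (\<eta> * u) = \<kappa> * u powi e *
      (u powi (d\<^sub>1 * int Q + d\<^sub>2 * int R + d\<^sub>3 * int S)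
       - u powi (d\<^sub>1 * int Q) - u powi (d\<^sub>2 * int R) - u powi (d\<^sub>3 * int S) - 1)"
  shows "bij (\<lambda>x. x ^ r * B (x ^ (q - 1))) \<longleftrightarrow>
    [q = 1] (mod 3) \<and> gcd r (q - 1) = 1 \<and> coprime (int Q + int R - int S) (int (q + 1))"
proof -
  have char: "CHAR('a) = p"
    using card assms(1) unfolding q
    by (intro CHAR_eq_of_CARD_prime_power[of p "k * 2"]) (simp_all add: power_mult)
  have char_prime: "prime CHAR('a)"
    using assms(1) char by simp
  note char_q = q[folded char] and char_Q = Q[folded char]
    and char_R = R[folded char] and char_S = S[folded char]
  have "q > 1"
    unfolding q using assms(1,3) prime_gt_1_nat by (intro one_less_power) auto
  have card': "CARD('a) - 1 = (q - 1) * (q + 1)"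
    using card by (simp add: algebra_simps power2_eq_square)
  have "\<not> 3 dvd q"
    using assms(1,2) prime_dvd_power[of 3 p k] primes_dvd_imp_eq[of 3 p] unfolding q by auto
  obtain w :: 'a where w: "w\<^sup>2 + w + 1 = 0" "w \<noteq> 1"
    using obtain_cube_root[OF card \<open>\<not> 3 dvd q\<close>] .
  note w' = cube_root_eqs[OF w(1)]
  let ?M = "unity_roots (q + 1) :: 'a set"
  let ?g = "\<lambda>x. x ^ r * B x ^ (q - 1)"
  let ?m = "s * (int Q + int R - int S)"
  have \<eta>\<eta> [simp]: "\<eta> * \<eta> = 1" "\<eta> * (\<eta> * x) = x" for x
    using \<eta> by auto
  have \<eta>_pow: "\<eta> ^ q = \<eta>" "\<eta> ^ Q = \<eta>" "\<eta> ^ R = \<eta>" "\<eta> ^ S = \<eta>"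
    using sign_power_char[OF char_prime _ \<eta>] char_q char_Q char_R char_S by blast+
  have \<kappa>_pow: "\<kappa> ^ q = \<kappa>"
    using sign_power_char[OF char_prime _ \<kappa>] char_q by blast
  have \<eta>M: "\<eta> * x \<in> ?M" if "x \<in> ?M" for x
    using that \<eta>_pow(1) by (intro mult_in_unity_roots) (auto simp: unity_roots_def)
  have bij_\<eta>: "bij_betw ((*) \<eta>) ?M ?M"
    by (rule bij_betw_byWitness[of _ "(*) \<eta>"]) (auto intro: \<eta>M simp del: One_nat_def)
  have B_zero: "\<not> bij_betw ?g ?M ?M" if "x \<in> ?M" "B x = 0" for x
  proof
    assume "bij_betw ?g ?M ?M"
    then have "?g x \<in> ?M"
      using that(1) by (rule bij_betw_apply)
    then have "(0::'a) \<in> ?M"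
      using that(2) \<open>q > 1\<close> by (simp add: power_0_left del: One_nat_def)
    then show False
      using unity_roots_nonzero by fastforce
  qed
  have q1: "[q = 1] (mod 3)" if bij: "bij_betw ?g ?M ?M"
  proof (rule ccontr)
    assume "\<not> [q = 1] (mod 3)"
    then have "3 dvd q + 1"
      using \<open>\<not> 3 dvd q\<close> unfolding cong_def by presburger
    then have "w \<in> ?M"
      using w'(1) by (auto simp: unity_roots_def power_mult simp del: power_Suc)
    \<comment> \<open>Modulo 3 the exponents reduce to \<open>s\<close>, \<open>s\<close>, \<open>- s\<close>, so \<open>B\<close> vanishes at \<open>\<eta> * w\<close> by \<open>1 + w + w\<^sup>2 = 0\<close>.\<close>
    have sgn: "w powi m = w powi t" if "[m = t] (mod 3)" for m t
      using powi_mod_order[of w 3] w' that by simp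
    have exps: "w powi (d\<^sub>1 * int Q) = w powi s" "w powi (d\<^sub>2 * int R) = w powi s"
      "w powi (d\<^sub>3 * int S) = w powi (- s)"
      using cong_scalar_left[OF mod3(1), of d\<^sub>1] cong_scalar_left[OF mod3(2), of d\<^sub>2]
        cong_scalar_left[OF mod3(3), of d\<^sub>3] d by (auto intro!: sgn)
    have "B (\<eta> * w) = \<kappa> * w powi e *
        (w powi s * w powi s * w powi (- s) - w powi s - w powi s - w powi (- s) - 1)"
      using B[OF w'(2)] w'(2) by (simp add: power_int_add exps)
    also have "w powi s * w powi s * w powi (- s) - w powi s - w powi s - w powi (- s) - 1 = 0"
    proof -
      have "w * w * w\<^sup>2 - w - w - w\<^sup>2 - 1 = 0" "w\<^sup>2 * w\<^sup>2 * w - w\<^sup>2 - w\<^sup>2 - w - 1 = 0"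
        using w(1) by algebra+
      moreover have "inverse (w\<^sup>2) = w"
        by (simp flip: w'(3))
      ultimately show ?thesis
        using s w'(3) by (auto simp: power_int_minus)
    qed
    finally show False
      using B_zero[OF \<eta>M[OF \<open>w \<in> ?M\<close>]] bij by simp
  qed
  have "bij_betw ?g ?M ?M \<longleftrightarrow> coprime (int Q + int R - int S) (int (q + 1))" if q1: "[q = 1] (mod 3)"
  proof -
    note twist_M = twist_unity_roots[OF char_prime char_q w q1]
    have bij_twist: "bij_betw (twist w) ?M ?M"
      by (rule bij_betw_byWitness[of _ "twist w"]) (auto intro: twist_M simp del: One_nat_def)
    have "w\<^sup>2 \<noteq> 1"
      using w' w(2) by (metis inverse_eq_1_iff)
    have g_eq: "?g (\<eta> * u) = \<eta> * twist w (twist w u powi ?m)" if u: "u \<in> ?M" for u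
    proof -
      have "u \<noteq> 0"
        using unity_roots_nonzero[OF u] by simp
      define a b c where "a = u powi (d\<^sub>1 * int Q)" and "b = u powi (d\<^sub>2 * int R)"
        and "c = u powi (d\<^sub>3 * int S)"
      define H K where "H = a * b * c - a - b - c - 1"
        and "K = 1 - a * b - a * c - b * c - a * b * c"
      have in_M: "a \<in> ?M" "b \<in> ?M" "c \<in> ?M"
        using powi_in_unity_roots[OF u] by (simp_all add: a_def b_def c_def)
      have nz: "a \<noteq> 0" "b \<noteq> 0" "c \<noteq> 0"
        using \<open>u \<noteq> 0\<close> by (simp_all add: a_def b_def c_def)
      have "twist w u \<noteq> 0"
        using unity_roots_nonzero[OF twist_M(3)[OF u]] by simp
      have "twist w a = twist w u powi (s * int Q)" "twist w b = twist w u powi (s * int R)"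
        "twist w c = twist w u powi (- s * int S)"
        unfolding a_def b_def c_def
        using twist_powi[OF char_prime char_Q w(1) \<open>u \<noteq> 0\<close> d(1) s mod3(1)]
          twist_powi[OF char_prime char_R w(1) \<open>u \<noteq> 0\<close> d(2) s mod3(2)]
          twist_powi[OF char_prime char_S w(1) \<open>u \<noteq> 0\<close> d(3) _ mod3(3)] s by auto
      then have T: "twist w a * twist w b * twist w c = twist w u powi ?m"
        using \<open>twist w u \<noteq> 0\<close> by (simp add: algebra_simps flip: power_int_add)
      then have "twist w a * twist w b * twist w c \<in> ?M"
        using powi_in_unity_roots[OF twist_M(3)[OF u]] by simp
      \<comment> \<open>Membership excludes the pole of the outer twist, which shows that \<open>B\<close> has no zero here.\<close>
      then have T_ne: "twist w a * twist w b * twist w c \<noteq> w\<^sup>2"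
        using twist_M(1)[OF u] by auto
      note product = twist_triple_product[OF w(1) \<open>w\<^sup>2 \<noteq> 1\<close> twist_M(2)[OF in_M(1)]
          twist_M(2)[OF in_M(2)] twist_M(2)[OF in_M(3)] T_ne, folded H_def K_def]
      have conj: "v ^ q = inverse v" if "v \<in> ?M" for v
        using that by (intro inverse_unique[symmetric]) (simp add: unity_roots_def)
      have "H ^ q = inverse (a * b * c) - inverse a - inverse b - inverse c - 1"
        by (simp add: H_def frobenius_minus[OF char_prime char_q] power_mult_distrib conj[OF in_M(1)]
            conj[OF in_M(2)] conj[OF in_M(3)])
      also have "\<dots> = K / (a * b * c)"
        using nz by (simp add: K_def field_simps)
      finally have Hq: "H ^ q = K / (a * b * c)" .
      have B_eq: "B (\<eta> * u) = \<kappa> * u powi e * H"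
        using B[OF \<open>u \<noteq> 0\<close>] \<open>u \<noteq> 0\<close> by (simp add: H_def a_def b_def c_def power_int_add)
      have "\<kappa> \<noteq> 0"
        using \<kappa> by auto
      have "B (\<eta> * u) ^ (q - 1) = B (\<eta> * u) ^ q / B (\<eta> * u)"
        using product(1) \<open>u \<noteq> 0\<close> \<open>\<kappa> \<noteq> 0\<close> \<open>q > 1\<close>
        by (intro power_minus_one_eq_quotient) (simp_all add: B_eq)
      also have "\<dots> = (\<kappa> * inverse (u powi e) * (K / (a * b * c))) / (\<kappa> * u powi e * H)"
        using conj[OF powi_in_unity_roots[OF u]] by (simp add: B_eq power_mult_distrib \<kappa>_pow Hq)
      also have "\<dots> = K / (u powi e * u powi e * (a * b * c) * H)"
        using \<open>\<kappa> \<noteq> 0\<close> by (simp add: divide_simps)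
      also have "u powi e * u powi e * (a * b * c) = u ^ (Q + R + S)"
      proof -
        have "u powi e * u powi e * (a * b * c) =
            u powi (2 * e + d\<^sub>1 * int Q + d\<^sub>2 * int R + d\<^sub>3 * int S)"
          using \<open>u \<noteq> 0\<close> unfolding a_def b_def c_def by (simp add: algebra_simps flip: power_int_add)
        then show ?thesis
          unfolding e by (simp only: power_int_of_nat)
      qed
      finally have Bq: "B (\<eta> * u) ^ (q - 1) = K / (u ^ (Q + R + S) * H)" .
      have "(\<eta> * u) ^ r = (\<eta> * u) ^ (Q + R + S)"
        using \<eta>M[OF u] by (intro power_mod_order[OF _ r]) (simp add: unity_roots_def)
      also have "\<dots> = \<eta> * u ^ (Q + R + S)"
        by (simp add: power_mult_distrib power_add \<eta>_pow)
      finally have "?g (\<eta> * u) = \<eta> * (K / H)"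
        unfolding Bq using \<open>u \<noteq> 0\<close> by simp
      also have "K / H = twist w (twist w u powi ?m)"
        using product(2) T by simp
      finally show ?thesis .
    qed
    \<comment> \<open>Strip the bijections surrounding the power map.\<close>
    have "bij_betw ?g ?M ?M \<longleftrightarrow> bij_betw (?g \<circ> (*) \<eta>) ?M ?M"
      by (rule bij_betw_comp_iff[OF bij_\<eta>])
    also have "\<dots> \<longleftrightarrow> bij_betw ((*) \<eta> \<circ> (twist w \<circ> ((\<lambda>y. y powi ?m) \<circ> twist w))) ?M ?M"
      by (rule bij_betw_cong) (simp add: g_eq del: One_nat_def)
    also have "\<dots> \<longleftrightarrow> bij_betw (twist w \<circ> ((\<lambda>y. y powi ?m) \<circ> twist w)) ?M ?M"
      by (intro bij_betw_comp_iff2[OF bij_\<eta>, symmetric])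
        (auto intro!: twist_M(3) powi_in_unity_roots simp del: One_nat_def)
    also have "\<dots> \<longleftrightarrow> bij_betw ((\<lambda>y. y powi ?m) \<circ> twist w) ?M ?M"
      by (intro bij_betw_comp_iff2[OF bij_twist, symmetric])
        (auto intro!: twist_M(3) powi_in_unity_roots simp del: One_nat_def)
    also have "\<dots> \<longleftrightarrow> bij_betw (\<lambda>y. y powi ?m) ?M ?M"
      by (rule bij_betw_comp_iff[OF bij_twist, symmetric])
    also have "\<dots> \<longleftrightarrow> coprime ?m (int (q + 1))"
      by (rule bij_betw_powi_unity_roots_iff[OF card']) simp
    also have "\<dots> \<longleftrightarrow> coprime (int Q + int R - int S) (int (q + 1))"
      using s by auto
    finally show ?thesis .
  qed
  then have "bij_betw ?g ?M ?M \<longleftrightarrow>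
      [q = 1] (mod 3) \<and> coprime (int Q + int R - int S) (int (q + 1))"
    using q1 by blast
  moreover have "bij (\<lambda>x. x ^ r * B (x ^ (q - 1))) \<longleftrightarrow> gcd r (q - 1) = 1 \<and> bij_betw ?g ?M ?M"
    using \<open>q > 1\<close> by (intro bij_power_mult_iff[OF card']) (simp_all add: r_pos)
  ultimately show ?thesis
    by argo
qed

section \<open>The six families of polynomials\<close>

theorem corollary1p9:
  fixes p k q Q R S r :: nat
    and B f :: "'a::{field, finite} poly"
  assumes "prime p" and "p \<noteq> 3" and "k > 0" and "q = p ^ k"
    and "CARD('a) = q ^ 2"
    and "\<exists>i. Q = p ^ i" and "\<exists>i. R = p ^ i" and "\<exists>i. S = p ^ i"
    and "r > 0" and "[r = Q + R + S] (mod (q + 1))"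
    and "(B = X ^ (Q + R) - X ^ (Q + S) - X ^ (R + S) + X ^ S - 1 \<and> cong_pm_3 (Q, R, S) (1, 1, 1))
       \<or> (B = X ^ (Q + R) - X ^ (Q + S) - X ^ (R + S) - X ^ S - 1 \<and> cong_pm_3 (Q, R, S) (1, 1, 1))
       \<or> (B = X ^ (R + S) - X ^ (Q + R) - X ^ (Q + S) + X ^ Q - 1 \<and> cong_pm_3 (Q, R, S) (1, -1, 1))
       \<or> (B = X ^ (R + S) - X ^ (Q + R) - X ^ (Q + S) - X ^ Q - 1 \<and> cong_pm_3 (Q, R, S) (1, -1, 1))
       \<or> (B = X ^ (Q + R + S) - X ^ Q - X ^ R - X ^ S + 1 \<and> cong_pm_3 (Q, R, S) (1, 1, -1))
       \<or> (B = X ^ (Q + R + S) - X ^ Q - X ^ R - X ^ S - 1 \<and> cong_pm_3 (Q, R, S) (1, 1, -1))"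
    and "f = X ^ r * pcompose B (X ^ (q - 1))"
  shows "permutation_poly f \<longleftrightarrow>
    [q = 1] (mod 3) \<and> gcd r (q - 1) = 1 \<and> gcd (int Q + int R - int S) (int q + 1) = 1"
proof -
  obtain i j l where exps: "Q = p ^ i" "R = p ^ j" "S = p ^ l"
    using assms(6-8) by blast
  have char: "CHAR('a) = p"
    using assms(1,5) unfolding assms(4)
    by (intro CHAR_eq_of_CARD_prime_power[of p "k * 2"]) (simp_all add: power_mult)
  have neg: "(- u) ^ Q = - (u ^ Q)" "(- u) ^ R = - (u ^ R)" "(- u) ^ S = - (u ^ S)" for u :: 'a
    using sign_power_char[of _ _ "- 1 :: 'a", unfolded char, OF assms(1)] exps
      power_minus[of u Q] power_minus[of u R] power_minus[of u S] by auto
  note criterion = twisted_product_permutes_iff[OF assms(1-5) exps assms(9,10), of _ _ _ _ _ _ _ "poly B"]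
  \<comment> \<open>The sign \<open>\<eta>\<close> is \<open>- 1\<close> in the first, third and fifth case. The negative exponent among the three
    factors sits at \<open>S\<close> in the first two cases, at \<open>Q\<close> in the next two, and is absent in the last two.
    The sign common to the three congruences is the residue of \<open>R\<close>, hence \<open>- s\<close> in the middle two cases;
    the constant term \<open>+ 1\<close> forces \<open>\<kappa> = - 1\<close> in the fifth.\<close>
  have "bij (\<lambda>x. x ^ r * poly B (x ^ (q - 1))) \<longleftrightarrow>
      [q = 1] (mod 3) \<and> gcd r (q - 1) = 1 \<and> coprime (int Q + int R - int S) (int (q + 1))"
    using assms(11)
  proof (elim disjE conjE)
    assume B: "B = X ^ (Q + R) - X ^ (Q + S) - X ^ (R + S) + X ^ S - 1"
      and "cong_pm_3 (Q, R, S) (1, 1, 1)"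
    then obtain s where s: "s \<in> {1, -1}" "[int Q = s * 1] (mod 3)" "[int R = s * 1] (mod 3)"
      "[int S = s * 1] (mod 3)"
      unfolding cong_pm_3_def prod.case by blast
    show ?thesis
      by (rule criterion[of "-1" 1 1 1 "-1" s "int S"])
        (use s in \<open>auto simp: B neg power_add power_int_add power_int_diff power_int_minus field_simps\<close>)
  next
    assume B: "B = X ^ (Q + R) - X ^ (Q + S) - X ^ (R + S) - X ^ S - 1"
      and "cong_pm_3 (Q, R, S) (1, 1, 1)"
    then obtain s where s: "s \<in> {1, -1}" "[int Q = s * 1] (mod 3)" "[int R = s * 1] (mod 3)"
      "[int S = s * 1] (mod 3)"
      unfolding cong_pm_3_def prod.case by blast
    show ?thesis
      by (rule criterion[of 1 1 1 1 "-1" s "int S"])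
        (use s in \<open>auto simp: B power_add power_int_add power_int_diff power_int_minus field_simps\<close>)
  next
    assume B: "B = X ^ (R + S) - X ^ (Q + R) - X ^ (Q + S) + X ^ Q - 1"
      and "cong_pm_3 (Q, R, S) (1, -1, 1)"
    then obtain s where s: "s \<in> {1, -1}" "[int Q = s * 1] (mod 3)" "[int R = s * - 1] (mod 3)"
      "[int S = s * 1] (mod 3)"
      unfolding cong_pm_3_def prod.case by blast
    show ?thesis
      by (rule criterion[of "-1" 1 "-1" 1 1 "-s" "int Q"])
        (use s in \<open>auto simp: B neg power_add power_int_add power_int_diff power_int_minus field_simps\<close>)
  next
    assume B: "B = X ^ (R + S) - X ^ (Q + R) - X ^ (Q + S) - X ^ Q - 1"
      and "cong_pm_3 (Q, R, S) (1, -1, 1)"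
    then obtain s where s: "s \<in> {1, -1}" "[int Q = s * 1] (mod 3)" "[int R = s * - 1] (mod 3)"
      "[int S = s * 1] (mod 3)"
      unfolding cong_pm_3_def prod.case by blast
    show ?thesis
      by (rule criterion[of 1 1 "-1" 1 1 "-s" "int Q"])
        (use s in \<open>auto simp: B power_add power_int_add power_int_diff power_int_minus field_simps\<close>)
  next
    assume B: "B = X ^ (Q + R + S) - X ^ Q - X ^ R - X ^ S + 1"
      and "cong_pm_3 (Q, R, S) (1, 1, -1)"
    then obtain s where s: "s \<in> {1, -1}" "[int Q = s * 1] (mod 3)" "[int R = s * 1] (mod 3)"
      "[int S = s * - 1] (mod 3)"
      unfolding cong_pm_3_def prod.case by blast
    show ?thesis
      by (rule criterion[of "-1" "-1" 1 1 1 s 0])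
        (use s in \<open>auto simp: B neg power_add power_int_add algebra_simps\<close>)
  next
    assume B: "B = X ^ (Q + R + S) - X ^ Q - X ^ R - X ^ S - 1"
      and "cong_pm_3 (Q, R, S) (1, 1, -1)"
    then obtain s where s: "s \<in> {1, -1}" "[int Q = s * 1] (mod 3)" "[int R = s * 1] (mod 3)"
      "[int S = s * - 1] (mod 3)"
      unfolding cong_pm_3_def prod.case by blast
    show ?thesis
      by (rule criterion[of 1 1 1 1 1 s 0])
        (use s in \<open>auto simp: B power_add power_int_add algebra_simps\<close>)
  qed
  moreover have "poly f = (\<lambda>x. x ^ r * poly B (x ^ (q - 1)))"
    by (simp add: assms(12) poly_pcompose fun_eq_iff)
  ultimately show ?thesis
    by (simp add: permutation_poly_def coprime_iff_gcd_eq_1 add.commute)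
qed

end
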